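(* Let $\Gamma=\mathbb{Z}^\ell$, let $\sigma:\Gamma\to\Gamma$ be a group homomorphism, let $\mathcal{A}$ be a finite list of elements of $\Gamma$ and $\sigma(\mathcal{A})$ the list of images, and let $G=(S^1)^p\times\mathbb{R}^q$ with $p>0$. Then $$\chi^G_{\sigma(\mathcal{A})}(0)=|\det(\sigma)|^p\cdot\chi^G_{\mathcal{A}}(0).$$
   Context: For a sublist $\mathcal{S}$ (sublists distinguished by index) of a finite list in a finitely generated abelian group $\Gamma$: $r_{\mathcal{S}}$ is the rank of $\langle\mathcal{S}\rangle$, $m(\mathcal{S};G)=\#\mathrm{Hom}((\Gamma/\langle\mathcal{S}\rangle)_{\mathrm{tor}},G)$, and the $G$-characteristic polynomial is $\chi^G_{\mathcal{A}}(t)=\sum_{\mathcal{S}\subset\mathcal{A}}(-1)^{\#\mathcal{S}}m(\mathcal{S};G)\,t^{r_\Gamma-r_{\mathcal{S}}}$, where $r_\Gamma$ is the rank of $\Gamma$. *)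

theory Defs
  imports "HOL-Analysis.Analysis" "HOL-Computational_Algebra.Polynomial"
begin

text \<open>The ambient group Gamma = Z^l is modelled as int ^ 'n (l = CARD('n)).\<close>

definition zspan :: "(int ^ 'n) set \<Rightarrow> (int ^ 'n) set" where
  "zspan X = {v. \<exists>F c. finite F \<and> F \<subseteq> X \<and> v = (\<Sum>x\<in>F. c x *s x)}"

text \<open>Subgroup generated by the sublist of A with index set S.\<close>
definition gen_sub :: "(int ^ 'n) list \<Rightarrow> nat set \<Rightarrow> (int ^ 'n) set" where
  "gen_sub A S = zspan {A ! i | i. i \<in> S \<and> i < length A}"

definition zindep :: "(int ^ 'n) set \<Rightarrow> bool" where
  "zindep L \<longleftrightarrow> (\<forall>c. (\<Sum>v\<in>L. c v *s v) = 0 \<longrightarrow> (\<forall>v\<in>L. c v = 0))"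

text \<open>Rank of a subgroup: maximal number of Z-linearly independent elements.\<close>
definition zrank :: "(int ^ 'n) set \<Rightarrow> nat" where
  "zrank H = Max {card L | L. finite L \<and> L \<subseteq> H \<and> zindep L}"

definition coset :: "(int ^ 'n) set \<Rightarrow> int ^ 'n \<Rightarrow> (int ^ 'n) set" where
  "coset H x = {x + h | h. h \<in> H}"

text \<open>Torsion subgroup of Gamma / H, as a set of cosets.\<close>
definition tor_quot :: "(int ^ 'n) set \<Rightarrow> (int ^ 'n) set set" where
  "tor_quot H = {coset H x | x. \<exists>n::int. n > 0 \<and> n *s x \<in> H}"

text \<open>The group G = (S^1)^p x R^q, elements (z, r) with z i = 1 for i >= p,
  r i = 0 for i >= q.\<close>
definition G_carrier :: "nat \<Rightarrow> nat \<Rightarrow> ((nat \<Rightarrow> complex) \<times> (nat \<Rightarrow> real)) set" where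
  "G_carrier p q = {(z, r). (\<forall>i<p. norm (z i) = 1) \<and> (\<forall>i\<ge>p. z i = 1) \<and> (\<forall>i\<ge>q. r i = 0)}"

definition G_op :: "((nat \<Rightarrow> complex) \<times> (nat \<Rightarrow> real)) \<Rightarrow> ((nat \<Rightarrow> complex) \<times> (nat \<Rightarrow> real))
    \<Rightarrow> ((nat \<Rightarrow> complex) \<times> (nat \<Rightarrow> real))" where
  "G_op a b = ((\<lambda>i. fst a i * fst b i), (\<lambda>i. snd a i + snd b i))"

text \<open>Hom((Gamma/H)_tor, G).\<close>
definition hom_tor :: "(int ^ 'n) set \<Rightarrow> nat \<Rightarrow> nat \<Rightarrow>
    ((int ^ 'n) set \<Rightarrow> (nat \<Rightarrow> complex) \<times> (nat \<Rightarrow> real)) set" where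
  "hom_tor H p q = {\<phi>. \<phi> \<in> extensional (tor_quot H) \<and>
      (\<forall>c\<in>tor_quot H. \<phi> c \<in> G_carrier p q) \<and>
      (\<forall>x y. coset H x \<in> tor_quot H \<longrightarrow> coset H y \<in> tor_quot H \<longrightarrow>
          \<phi> (coset H (x + y)) = G_op (\<phi> (coset H x)) (\<phi> (coset H y)))}"

definition mult_G :: "(int ^ 'n) list \<Rightarrow> nat set \<Rightarrow> nat \<Rightarrow> nat \<Rightarrow> nat" where
  "mult_G A S p q = card (hom_tor (gen_sub A S) p q)"

text \<open>G-characteristic polynomial, sum over sublists (index sets).\<close>
definition char_poly_G :: "nat \<Rightarrow> nat \<Rightarrow> (int ^ 'n) list \<Rightarrow> int poly" where
  "char_poly_G p q A = (\<Sum>S\<in>Pow {..<length A}.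
     monom ((-1) ^ card S * int (mult_G A S p q))
           (zrank (UNIV :: (int ^ 'n) set) - zrank (gen_sub A S)))"

text \<open>Matrix of an endomorphism of Z^l (columns = images of basis vectors).\<close>
definition hom_matrix :: "(int ^ 'n \<Rightarrow> int ^ 'n) \<Rightarrow> int ^ 'n ^ 'n" where
  "hom_matrix \<sigma> = (\<chi> i j. \<sigma> (axis j 1) $ i)"

end

theory Submission
  imports Defs
begin

text \<open>
  Evaluating at \<open>t = 0\<close> keeps only the sublists \<open>S\<close> whose span \<open>H\<close> has full rank, i.e. for
  which \<open>\<Gamma>/H\<close> is finite. A homomorphism from a finite group into \<open>(S\<^sup>1)\<^sup>p \<times> \<real>\<^sup>q\<close> is trivial
  on the \<open>\<real>\<^sup>q\<close> factor, and each of its \<open>p\<close> circle components is a character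
  \<open>h \<mapsto> \<Prod>\<^sub>j t\<^sub>j powi h\<^sub>j\<close> of \<open>\<Gamma>\<close> that is trivial on \<open>H\<close>. Hence \<open>m(S;G) = |ann H|\<^sup>p\<close>, where
  \<open>ann H\<close> is the annihilator of \<open>H\<close> in the torus \<open>(S\<^sup>1)\<^sup>n\<close>. Writing \<open>\<sigma>\<close> as an integer matrix
  \<open>M\<close>, the annihilator of \<open>M H\<close> is the preimage of \<open>ann H\<close> under the torus endomorphism
  \<open>t \<mapsto> t\<^sup>M\<close>, which is \<open>|det M|\<close>-to-one when \<open>det M \<noteq> 0\<close>: this holds for shears and for
  diagonal matrices and propagates along a Euclidean reduction of \<open>M\<close>. As \<open>M\<close> is then
  injective it preserves ranks, so the full-rank terms correspond and each gains the factor
  \<open>|det M|\<^sup>p\<close>. If \<open>det M = 0\<close>, no sublist of \<open>\<sigma>(A)\<close> has full rank and both sides vanish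
  (here \<open>p > 0\<close> is used).
\<close>

section \<open>Additive maps and the lattice \<open>\<int>\<^sup>n\<close>\<close>

lemma additive_scale_int:
  fixes f :: "int ^ 'n \<Rightarrow> 'b::ring_1"
  assumes "Modules.additive f"
  shows "f (k *s x) = of_int k * f x"
proof (induction k rule: int_induct[where k = 0])
  case base
  show ?case using additive.zero[OF assms] by simp
next
  case (step1 i)
  have "(i + 1) *s x = i *s x + x" by (simp add: vec_eq_iff algebra_simps)
  then show ?case using step1 by (simp add: additive.add[OF assms] algebra_simps)
next
  case (step2 i)
  have "i *s x = (i - 1) *s x + x" by (simp add: vec_eq_iff algebra_simps)
  then have "f (i *s x) = f ((i - 1) *s x) + f x"
    by (metis additive.add[OF assms])
  then show ?case using step2 by (simp add: algebra_simps eq_diff_eq[symmetric])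
qed

lemma additive_eq_hom_matrix:
  fixes \<sigma> :: "int ^ 'n \<Rightarrow> int ^ 'm"
  assumes "Modules.additive \<sigma>"
  shows "\<sigma> x = (\<chi> i j. \<sigma> (axis j 1) $ i) *v x"
proof -
  have "\<sigma> x $ i = (\<Sum>j\<in>UNIV. x $ j * \<sigma> (axis j 1) $ i)" for i
  proof -
    have component: "Modules.additive (\<lambda>x. \<sigma> x $ i)"
      using assms by (simp add: Modules.additive_def)
    have "\<sigma> x $ i = \<sigma> (\<Sum>j\<in>UNIV. x $ j *s axis j 1) $ i"
      by (simp add: basis_expansion)
    also have "\<dots> = (\<Sum>j\<in>UNIV. x $ j * \<sigma> (axis j 1) $ i)"
      by (simp add: additive.sum[OF component] additive_scale_int[OF component])
    finally show ?thesis .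
  qed
  then show ?thesis
    by (simp add: vec_eq_iff matrix_vector_mult_def mult.commute)
qed

interpretation int_vec: module "(*s) :: int \<Rightarrow> int ^ 'n \<Rightarrow> int ^ 'n"
  by unfold_locales (simp_all add: vec_eq_iff algebra_simps)

lemma zspan_eq_span: "zspan X = int_vec.span X"
  unfolding zspan_def int_vec.span_explicit by blast

lemma module_hom_matrix_vector_mult:
  "module_hom ((*s) :: int \<Rightarrow> _) (*s) ((*v) (M :: int ^ 'm ^ 'n))"
  by unfold_locales
    (simp_all add: vec_eq_iff matrix_vector_mult_def sum.distrib sum_distrib_left algebra_simps)

lemma zspan_matrix_image: "zspan ((*v) M ` X) = (*v) (M :: int ^ 'm ^ 'n) ` zspan X"
  unfolding zspan_eq_span by (rule module_hom.span_image[OF module_hom_matrix_vector_mult])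

section \<open>Rank\<close>

definition rat_vec :: "int ^ 'n \<Rightarrow> rat ^ 'n" where
  "rat_vec x = (\<chi> i. of_int (x $ i))"

definition rat_mat :: "int ^ 'n ^ 'm \<Rightarrow> rat ^ 'n ^ 'm" where
  "rat_mat M = (\<chi> i j. of_int (M $ i $ j))"

lemma inj_rat_vec: "inj rat_vec"
  by (rule injI) (simp add: rat_vec_def vec_eq_iff)

lemma rat_vec_lincomb: "rat_vec (\<Sum>v\<in>L. c v *s v) = (\<Sum>v\<in>L. of_int (c v) *s rat_vec v)"
  by (simp add: rat_vec_def vec_eq_iff)

lemma rat_mat_mult_rat_vec: "rat_mat M *v rat_vec x = rat_vec (M *v x)"
  by (simp add: rat_mat_def rat_vec_def vec_eq_iff matrix_vector_mult_def)

lemma det_rat_mat: "det (rat_mat M) = of_int (det M)"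
  unfolding det_def rat_mat_def by simp

lemma rat_common_denominator:
  "finite F \<Longrightarrow> \<exists>D::int. D > 0 \<and> (\<forall>q\<in>F. of_int D * (q::rat) \<in> \<int>)"
proof (induction F rule: finite_induct)
  case empty
  show ?case by (intro exI[of _ 1]) simp
next
  case (insert q F)
  then obtain D where D: "D > 0" "\<forall>q\<in>F. of_int D * q \<in> \<int>" by blast
  obtain a b where qb: "quotient_of q = (a, b)" by (cases "quotient_of q")
  have b: "b > 0" using qb by (rule quotient_of_denom_pos)
  have "of_int (D * b) * q = of_int (D * a)"
    using b quotient_of_div[OF qb] by simp
  then have "of_int (D * b) * q \<in> \<int>" by (metis Ints_of_int)
  moreover have "of_int (D * b) * q' \<in> \<int>" if "q' \<in> F" for q'
  proof -
    have "of_int D * q' \<in> \<int>" using D(2) that by blast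
    then have "of_int b * (of_int D * q') \<in> \<int>" by simp
    then show ?thesis by (simp add: mult_ac)
  qed
  ultimately show ?case
    using D(1) b by (intro exI[of _ "D * b"]) auto
qed

lemma zindep_rat_independent:
  assumes "finite L" "zindep L"
  shows "vec.independent (rat_vec ` L)"
  unfolding vec.independent_explicit
proof (intro conjI allI impI ballI)
  show "finite (rat_vec ` L)" using assms(1) by simp
next
  fix c w assume sum0: "(\<Sum>w\<in>rat_vec ` L. c w *s w) = 0" and "w \<in> rat_vec ` L"
  then obtain v where v: "v \<in> L" "w = rat_vec v" by blast
  obtain D where D: "D > 0" "\<forall>q\<in>(\<lambda>v. c (rat_vec v)) ` L. of_int D * q \<in> \<int>"
    using rat_common_denominator[of "(\<lambda>v. c (rat_vec v)) ` L"] assms(1) by blast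
  define d where "d v = \<lfloor>of_int D * c (rat_vec v)\<rfloor>" for v
  have d: "of_int (d v) = of_int D * c (rat_vec v)" if "v \<in> L" for v
    using D(2) that unfolding d_def by (auto elim!: Ints_cases)
  have "rat_vec (\<Sum>v\<in>L. d v *s v) = (\<Sum>v\<in>L. (of_int D * c (rat_vec v)) *s rat_vec v)"
    unfolding rat_vec_lincomb by (rule sum.cong) (simp_all add: d)
  also have "\<dots> = of_int D *s (\<Sum>w\<in>rat_vec ` L. c w *s w)"
    by (simp add: sum.reindex inj_on_subset[OF inj_rat_vec] vec_eq_iff sum_distrib_left mult.assoc)
  also have "\<dots> = rat_vec 0"
    using sum0 by (simp add: rat_vec_def vec_eq_iff)
  finally have "(\<Sum>v\<in>L. d v *s v) = 0"
    by (rule injD[OF inj_rat_vec])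
  then have "d v = 0" using assms(2) v(1) unfolding zindep_def by blast
  then show "c w = 0" using d[OF v(1)] D(1) v(2) by simp
qed

lemma zindep_card_le:
  assumes "finite L" "zindep (L :: (int ^ 'n) set)"
  shows "card L \<le> CARD('n)"
proof -
  have "card (rat_vec ` L) \<le> vec.dim (UNIV :: (rat ^ 'n) set)"
    using zindep_rat_independent[OF assms] by (intro vec.independent_card_le_dim) auto
  then show ?thesis
    by (simp add: card_image inj_on_subset[OF inj_rat_vec] card_cart_basis)
qed

lemma finite_zindep_cards: "finite {card L | L. finite L \<and> L \<subseteq> (H :: (int ^ 'n) set) \<and> zindep L}"
  by (rule finite_subset[of _ "{..CARD('n)}"]) (auto dest: zindep_card_le)

lemma card_le_zrank: "finite L \<Longrightarrow> L \<subseteq> H \<Longrightarrow> zindep L \<Longrightarrow> card L \<le> zrank H"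
  unfolding zrank_def by (rule Max_ge[OF finite_zindep_cards]) blast

lemma zrank_attained: "\<exists>L. finite L \<and> L \<subseteq> H \<and> zindep L \<and> card L = zrank H"
proof -
  have "0 \<in> {card L | L. finite L \<and> L \<subseteq> H \<and> zindep L}"
    by (intro CollectI exI[of _ "{}"]) (simp add: zindep_def)
  then have "{card L | L. finite L \<and> L \<subseteq> H \<and> zindep L} \<noteq> {}" by blast
  then have "zrank H \<in> {card L | L. finite L \<and> L \<subseteq> H \<and> zindep L}"
    unfolding zrank_def by (rule Max_in[OF finite_zindep_cards])
  then obtain L where "zrank H = card L" "finite L" "L \<subseteq> H" "zindep L"
    by (elim CollectE exE conjE) simp
  then show ?thesis by (intro exI[of _ L]) simp
qed

lemma zrank_le_CARD: "zrank (H :: (int ^ 'n) set) \<le> CARD('n)"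
proof -
  obtain L :: "(int ^ 'n) set" where "finite L" "L \<subseteq> H" "zindep L" "card L = zrank H"
    using zrank_attained[of H] by blast
  then show ?thesis using zindep_card_le by metis
qed

lemma zrank_mono:
  assumes "H \<subseteq> H'"
  shows "zrank H \<le> zrank H'"
proof -
  obtain L where "finite L" "L \<subseteq> H" "zindep L" "card L = zrank H"
    using zrank_attained[of H] by blast
  then show ?thesis using card_le_zrank[of L H'] assms by simp
qed

lemma zrank_UNIV: "zrank (UNIV :: (int ^ 'n) set) = CARD('n)"
proof (rule antisym[OF zrank_le_CARD])
  let ?e = "\<lambda>j::'n. axis j (1::int)"
  have inj: "inj ?e" by (rule injI) (simp add: axis_eq_axis)
  have "zindep (range ?e)"
    unfolding zindep_def
  proof (intro allI impI ballI)
    fix c w assume sum0: "(\<Sum>v\<in>range ?e. c v *s v) = 0" and "w \<in> range ?e"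
    then obtain j where j: "w = ?e j" by blast
    have "(\<Sum>l\<in>UNIV. c (?e l) *s ?e l) $ j = 0"
      using sum0 by (simp add: sum.reindex[OF inj])
    then show "c w = 0" by (simp add: j axis_def if_distrib cong: if_cong)
  qed
  then have "card (range ?e) \<le> zrank (UNIV :: (int ^ 'n) set)"
    by (intro card_le_zrank) auto
  then show "CARD('n) \<le> zrank (UNIV :: (int ^ 'n) set)"
    by (simp add: card_image[OF inj])
qed

lemma zindep_iff_independent:
  assumes "finite L"
  shows "zindep L \<longleftrightarrow> int_vec.independent L"
proof
  assume indep: "zindep L"
  show "int_vec.independent L"
    unfolding int_vec.independent_explicit_module
  proof (intro allI impI)
    fix t u v assume t: "finite t" "t \<subseteq> L" "(\<Sum>v\<in>t. u v *s v) = 0" "v \<in> t"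
    define c where "c w = (if w \<in> t then u w else 0)" for w
    have "(\<Sum>w\<in>L. c w *s w) = (\<Sum>w\<in>L. if w \<in> t then u w *s w else 0)"
      unfolding c_def by (rule sum.cong) simp_all
    also have "\<dots> = 0"
      using assms t(1-3) by (simp add: sum.inter_restrict[symmetric] Int_absorb1)
    finally have "\<forall>w\<in>L. c w = 0"
      using indep unfolding zindep_def by blast
    then show "u v = 0" using t(2,4) unfolding c_def by (metis subsetD)
  qed
next
  assume "int_vec.independent L"
  then show "zindep L"
    unfolding zindep_def using int_vec.independentD[OF _ assms subset_refl] by blast
qed

lemma (in module_hom) independent_if_independent_image:
  assumes ind: "m2.independent (f ` S)" and inj: "inj_on f S"
  shows "m1.independent S"
proof
  assume "m1.dependent S"
  then obtain t u v where t: "finite t" "t \<subseteq> S" "(\<Sum>v\<in>t. u v *a v) = 0" "v \<in> t" "u v \<noteq> 0"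
    unfolding m1.dependent_explicit by blast
  have inv: "the_inv_into S f (f v) = v" if "v \<in> t" for v
    using the_inv_into_f_f[OF inj] that t(2) by blast
  have "(\<Sum>w\<in>f ` t. u (the_inv_into S f w) *b w) = (\<Sum>v\<in>t. u (the_inv_into S f (f v)) *b f v)"
    using inj_on_subset[OF inj t(2)] by (rule sum.reindex[unfolded comp_def])
  also have "\<dots> = (\<Sum>v\<in>t. u v *b f v)"
    by (rule sum.cong) (simp_all add: inv)
  also have "\<dots> = f (\<Sum>v\<in>t. u v *a v)" by (simp add: sum scale)
  finally have "(\<Sum>w\<in>f ` t. u (the_inv_into S f w) *b w) = 0" using t(3) by simp
  then have "u (the_inv_into S f (f v)) = 0"
    by (rule m2.independentD[OF ind finite_imageI[OF t(1)] image_mono[OF t(2)] _ imageI[OF t(4)]])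
  then show False using t(4,5) inv by simp
qed

lemma zrank_matrix_image:
  assumes inj: "inj ((*v) (M :: int ^ 'n ^ 'm))"
  shows "zrank ((*v) M ` H) = zrank H"
proof -
  interpret module_hom "(*s) :: int \<Rightarrow> _" "(*s)" "(*v) M"
    by (rule module_hom_matrix_vector_mult)
  have inj_on: "inj_on ((*v) M) L" for L
    using inj by (rule inj_on_subset) simp
  show ?thesis
  proof (rule antisym)
    obtain L' where L': "finite L'" "L' \<subseteq> (*v) M ` H" "zindep L'" "card L' = zrank ((*v) M ` H)"
      using zrank_attained by blast
    then obtain L where L: "L \<subseteq> H" "L' = (*v) M ` L"
      by (auto simp: subset_image_iff)
    have "finite L" using L'(1) L(2) finite_imageD inj_on by blast
    moreover have "zindep L"
      using L' L \<open>finite L\<close> independent_if_independent_image[OF _ inj_on]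
      by (simp add: zindep_iff_independent)
    ultimately have "card L \<le> zrank H" using L(1) by (intro card_le_zrank)
    then show "zrank ((*v) M ` H) \<le> zrank H"
      using L'(4) L(2) inj_on by (simp add: card_image)
  next
    obtain L where L: "finite L" "L \<subseteq> H" "zindep L" "card L = zrank H"
      using zrank_attained by blast
    have "zindep ((*v) M ` L)"
      using L(1,3) independent_inj_image[OF _ inj] by (simp add: zindep_iff_independent)
    then have "card ((*v) M ` L) \<le> zrank ((*v) M ` H)"
      using L(1,2) by (intro card_le_zrank) auto
    then show "zrank H \<le> zrank ((*v) M ` H)"
      using L(4) inj_on by (simp add: card_image)
  qed
qed

lemma zrank_full_imp_torsion:
  assumes "zrank H = CARD('n)"
  shows "\<exists>k>0. k *s x \<in> zspan (H :: (int ^ 'n) set)"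
proof -
  obtain L where L: "finite L" "L \<subseteq> H" "zindep L" "card L = CARD('n)"
    using zrank_attained[of H] assms by auto
  show ?thesis
  proof (cases "x \<in> L")
    case True
    then show ?thesis
      using L(2) by (intro exI[of _ 1]) (auto simp: zspan_eq_span int_vec.span_base)
  next
    case False
    then have "\<not> zindep (insert x L)"
      using zindep_card_le[of "insert x L"] L by auto
    then obtain c v where c: "c x *s x + (\<Sum>u\<in>L. c u *s u) = 0" "v \<in> insert x L" "c v \<noteq> 0"
      using False L(1) unfolding zindep_def by auto
    have "c x \<noteq> 0"
    proof
      assume "c x = 0"
      then have "\<forall>u\<in>L. c u = 0" using c(1) L(3) unfolding zindep_def by simp
      then show False using c(2,3) \<open>c x = 0\<close> by auto
    qed
    have sum_in: "(\<Sum>u\<in>L. c u *s u) \<in> zspan H"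
      unfolding zspan_eq_span using L(2)
      by (intro int_vec.span_sum int_vec.span_scale int_vec.span_base) auto
    have eq: "c x *s x = - (\<Sum>u\<in>L. c u *s u)"
      using c(1) by (simp add: eq_neg_iff_add_eq_0)
    then have "(- c x) *s x = (\<Sum>u\<in>L. c u *s u)"
      by simp
    moreover have "c x *s x \<in> zspan H"
      using sum_in unfolding eq zspan_eq_span by (rule int_vec.span_neg)
    ultimately show ?thesis
      using sum_in \<open>c x \<noteq> 0\<close> by (cases "c x > 0") (auto intro: exI[of _ "c x"] exI[of _ "- c x"])
  qed
qed

lemma inj_matrix_vector_mult_if_det_nonzero:
  assumes "det (M :: int ^ 'n ^ 'n) \<noteq> 0"
  shows "inj ((*v) M)"
proof (rule injI)
  fix x y assume "M *v x = M *v y"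
  then have "rat_mat M *v rat_vec x = rat_mat M *v rat_vec y"
    by (simp add: rat_mat_mult_rat_vec)
  moreover have "inj ((*v) (rat_mat M))"
    using assms det_nz_iff_inj_gen[of "(*v) (rat_mat M)"] by (simp add: det_rat_mat)
  ultimately show "x = y" by (metis injD inj_rat_vec)
qed

lemma det_nonzero_if_zrank_range:
  assumes "zrank (range ((*v) (M :: int ^ 'n ^ 'n))) = CARD('n)"
  shows "det M \<noteq> 0"
proof -
  have "\<exists>k v. k > 0 \<and> M *v v = k *s axis j 1" for j
  proof -
    obtain k where k: "k > 0" "k *s axis j 1 \<in> zspan (range ((*v) M))"
      using zrank_full_imp_torsion[OF assms] by blast
    then obtain u where "k *s axis j 1 = M *v u"
      using zspan_matrix_image[of M UNIV] by auto
    then show ?thesis using k(1) by metis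
  qed
  then obtain k v where kv: "\<And>j. k j > 0 \<and> M *v v j = k j *s axis j 1"
    by metis
  have "M ** (\<chi> i j. v j $ i) = (\<chi> i j. if i = j then k j else 0)"
    using kv by (simp add: vec_eq_iff matrix_matrix_mult_def axis_def
        flip: matrix_vector_mul_component) (simp add: matrix_vector_mult_def)
  then have "det M * det (\<chi> i j. v j $ i) = (\<Prod>j\<in>UNIV. k j)"
    by (simp add: det_mul[symmetric] det_diagonal)
  moreover have "(\<Prod>j\<in>UNIV. k j) \<noteq> 0"
    using kv by simp (metis less_irrefl)
  ultimately show ?thesis by auto
qed

section \<open>The torus endomorphism of an integer matrix\<close>

definition torus :: "('n \<Rightarrow> complex) set" where
  "torus = {t. \<forall>j. norm (t j) = 1}"

definition torus_map :: "int ^ 'n ^ 'n \<Rightarrow> ('n \<Rightarrow> complex) \<Rightarrow> ('n \<Rightarrow> complex)" where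
  "torus_map M t = (\<lambda>j. \<Prod>i\<in>UNIV. t i powi (M $ i $ j))"

definition torus_preimage :: "int ^ 'n ^ 'n \<Rightarrow> ('n \<Rightarrow> complex) set \<Rightarrow> ('n \<Rightarrow> complex) set" where
  "torus_preimage M Y = {t \<in> torus. torus_map M t \<in> Y}"

text \<open>The dual form of the index formula \<open>[\<int>\<^sup>n : M \<int>\<^sup>n] = \<bar>det M\<bar>\<close>:
  \<open>t \<mapsto> t\<^sup>M\<close> is \<open>\<bar>det M\<bar>\<close>-to-one on the torus.\<close>

definition torus_det_cover :: "int ^ 'n ^ 'n \<Rightarrow> bool" where
  "torus_det_cover M \<longleftrightarrow>
     (\<forall>Y \<subseteq> torus. card (torus_preimage M Y) = nat \<bar>det M\<bar> * card Y)"

lemma torus_nonzero: "t \<in> torus \<Longrightarrow> t i \<noteq> 0"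
  unfolding torus_def by (metis (mono_tags) mem_Collect_eq norm_zero zero_neq_one)

lemma power_int_prod: "(\<Prod>i\<in>F. f i) powi n = (\<Prod>i\<in>F. (f i :: 'a :: field) powi n)"
  by (induction F rule: infinite_finite_induct) (auto simp: power_int_mult_distrib)

lemma power_int_sum: "(x :: 'a :: field) \<noteq> 0 \<Longrightarrow> x powi (\<Sum>i\<in>F. g i) = (\<Prod>i\<in>F. x powi g i)"
  by (induction F rule: infinite_finite_induct) (simp_all add: power_int_add)

lemma torus_map_in_torus: "t \<in> torus \<Longrightarrow> torus_map M t \<in> torus"
  unfolding torus_def torus_map_def by (simp add: prod_norm[symmetric] norm_power_int)

lemma torus_map_mult:
  assumes "t \<in> torus"
  shows "torus_map (A ** B) t = torus_map B (torus_map A t)"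
proof
  fix l
  have "torus_map B (torus_map A t) l = (\<Prod>j\<in>UNIV. \<Prod>i\<in>UNIV. t i powi (A $ i $ j * B $ j $ l))"
    unfolding torus_map_def by (simp add: power_int_prod power_int_mult)
  also have "\<dots> = (\<Prod>i\<in>UNIV. \<Prod>j\<in>UNIV. t i powi (A $ i $ j * B $ j $ l))"
    by (rule prod.swap)
  also have "\<dots> = torus_map (A ** B) t l"
    unfolding torus_map_def matrix_matrix_mult_def
    using torus_nonzero[OF assms] by (simp add: power_int_sum)
  finally show "torus_map (A ** B) t l = torus_map B (torus_map A t) l" by simp
qed

lemma torus_preimage_mult: "torus_preimage (A ** B) Y = torus_preimage A (torus_preimage B Y)"
  unfolding torus_preimage_def by (auto simp: torus_map_mult torus_map_in_torus)

lemma torus_preimage_subset: "torus_preimage M Y \<subseteq> torus"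
  unfolding torus_preimage_def by auto

lemma torus_det_cover_mult:
  fixes A B :: "int ^ 'n ^ 'n"
  assumes "torus_det_cover A" "torus_det_cover B"
  shows "torus_det_cover (A ** B)"
  unfolding torus_det_cover_def
proof (intro allI impI)
  fix Y :: "('n \<Rightarrow> complex) set" assume "Y \<subseteq> torus"
  then have "card (torus_preimage (A ** B) Y) = nat \<bar>det A\<bar> * (nat \<bar>det B\<bar> * card Y)"
    using assms torus_preimage_subset unfolding torus_preimage_mult torus_det_cover_def by metis
  then show "card (torus_preimage (A ** B) Y) = nat \<bar>det (A ** B)\<bar> * card Y"
    by (simp add: det_mul abs_mult nat_mult_distrib)
qed

definition unimodular_cover :: "int ^ 'n ^ 'n \<Rightarrow> bool" where
  "unimodular_cover E \<longleftrightarrow> torus_det_cover E \<and> \<bar>det E\<bar> = 1"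

lemma unimodular_cover_mult:
  "unimodular_cover A \<Longrightarrow> unimodular_cover B \<Longrightarrow> unimodular_cover (A ** B)"
  by (simp add: unimodular_cover_def torus_det_cover_mult det_mul abs_mult)

lemma torus_det_cover_cancel_left:
  fixes E M :: "int ^ 'n ^ 'n"
  assumes "unimodular_cover E" "torus_det_cover (E ** M)"
  shows "torus_det_cover M"
  unfolding torus_det_cover_def
proof (intro allI impI)
  fix Y :: "('n \<Rightarrow> complex) set" assume "Y \<subseteq> torus"
  have "card (torus_preimage M Y) = card (torus_preimage (E ** M) Y)"
    using assms(1) torus_preimage_subset[of M Y]
    unfolding torus_preimage_mult unimodular_cover_def torus_det_cover_def by simp
  also have "\<dots> = nat \<bar>det M\<bar> * card Y"
    using assms \<open>Y \<subseteq> torus\<close> unfolding unimodular_cover_def torus_det_cover_def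
    by (simp add: det_mul abs_mult)
  finally show "card (torus_preimage M Y) = nat \<bar>det M\<bar> * card Y" .
qed

lemma torus_map_one: "torus_map (mat 1) t = t"
  by (auto simp: torus_map_def mat_def if_distrib cong: if_cong)

lemma abs_det_eq_1_if_right_inverse:
  assumes "A ** B = (mat 1 :: int ^ 'n ^ 'n)"
  shows "\<bar>det A\<bar> = 1"
proof -
  have "\<bar>det A * det B\<bar> = 1"
    using arg_cong[OF assms, of det] by (simp add: det_mul)
  then show ?thesis by (rule abs_zmult_eq_1)
qed

lemma torus_det_cover_if_inverse:
  fixes A B :: "int ^ 'n ^ 'n"
  assumes AB: "A ** B = mat 1" and BA: "B ** A = mat 1"
  shows "torus_det_cover A"
  unfolding torus_det_cover_def abs_det_eq_1_if_right_inverse[OF AB]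
proof (intro allI impI)
  fix Y :: "('n \<Rightarrow> complex) set" assume Y: "Y \<subseteq> torus"
  have inverse: "torus_map B (torus_map A t) = t" "torus_map A (torus_map B t) = t"
    if "t \<in> torus" for t
    using torus_map_mult[OF that, of A B] torus_map_mult[OF that, of B A]
    by (simp_all add: AB BA torus_map_one)
  have "torus_preimage A Y = torus_map B ` Y"
    using Y by (force simp: torus_preimage_def inverse torus_map_in_torus)
  moreover have "inj_on (torus_map B) Y"
    using Y by (metis inj_on_inverseI inverse(2) subsetD)
  ultimately show "card (torus_preimage A Y) = nat 1 * card Y"
    by (simp add: card_image)
qed

lemma torus_det_cover_one: "torus_det_cover (mat 1 :: int ^ 'n ^ 'n)"
  by (rule torus_det_cover_if_inverse) simp_all

definition shear_matrix :: "'n \<Rightarrow> ('n \<Rightarrow> int) \<Rightarrow> int ^ 'n ^ 'n" where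
  "shear_matrix k r = (\<chi> i j. if i = j then 1 else if i = k then r j else 0)"

lemma shear_matrix_mult: "shear_matrix k r ** shear_matrix k s = shear_matrix k (\<lambda>j. r j + s j)"
proof -
  have "(\<Sum>l\<in>UNIV. shear_matrix k r $ i $ l * shear_matrix k s $ l $ j)
      = (if i = j then 1 else if i = k then r j + s j else 0)" for i j
  proof -
    have "shear_matrix k r $ i $ l * shear_matrix k s $ l $ j
        = (if l = i then shear_matrix k s $ i $ j else 0)
          + (if i = k \<and> i \<noteq> j \<and> l = j then r j else 0)" for l
      by (auto simp: shear_matrix_def)
    then show ?thesis by (simp add: sum.distrib shear_matrix_def)
  qed
  then show ?thesis by (simp add: matrix_matrix_mult_def shear_matrix_def)
qed

lemma shear_matrix_zero: "shear_matrix k (\<lambda>j. 0) = mat 1"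
  by (simp add: shear_matrix_def mat_def vec_eq_iff)

lemma shear_matrix_inverse: "shear_matrix k r ** shear_matrix k (\<lambda>j. - r j) = mat 1"
  by (simp add: shear_matrix_mult shear_matrix_zero)

lemma abs_det_shear_matrix: "\<bar>det (shear_matrix k r)\<bar> = 1"
  by (rule abs_det_eq_1_if_right_inverse[OF shear_matrix_inverse])

lemma torus_det_cover_shear_matrix: "torus_det_cover (shear_matrix k r)"
  using shear_matrix_inverse[of k r] shear_matrix_inverse[of k "\<lambda>j. - r j"]
  by (intro torus_det_cover_if_inverse) simp_all

lemma card_eq_mult_card_if_uniform_fibres:
  assumes img: "f ` A = B" and fib: "\<And>b. b \<in> B \<Longrightarrow> card {a\<in>A. f a = b} = m" and m: "m > 0"
  shows "card A = m * card B"
proof (cases "finite B")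
  case True
  have A: "A = (\<Union>b\<in>B. {a\<in>A. f a = b})" using img by blast
  have "finite {a\<in>A. f a = b}" if "b \<in> B" for b
    using fib[OF that] m card.infinite by force
  then have "card A = (\<Sum>b\<in>B. card {a\<in>A. f a = b})"
    by (subst A, intro card_UN_disjoint True) auto
  then show ?thesis using fib by simp
next
  case False
  then have "infinite A" using img by blast
  then show ?thesis using False by simp
qed

lemma power_int_eq_iff_power:
  "(z :: 'a :: field) powi g = c \<longleftrightarrow> z ^ nat \<bar>g\<bar> = (if g \<ge> 0 then c else inverse c)"
  by (cases "g \<ge> 0") (auto simp: power_int_def power_inverse)

lemma card_power_int_roots:
  assumes "(c :: complex) \<noteq> 0" "g \<noteq> 0"
  shows "card {z. z powi g = c} = nat \<bar>g\<bar>"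
  using card_nth_roots[of "if g \<ge> 0 then c else inverse c" "nat \<bar>g\<bar>"] assms
  by (simp add: power_int_eq_iff_power)

lemma norm_eq_1_if_power_int_eq:
  assumes "(z :: complex) powi g = c" "norm c = 1" "g \<noteq> 0"
  shows "norm z = 1"
proof -
  have "norm z ^ nat \<bar>g\<bar> = 1"
    using arg_cong[OF assms(1)[unfolded power_int_eq_iff_power], of norm] assms(2)
    by (simp add: norm_power norm_inverse split: if_splits)
  moreover have "nat \<bar>g\<bar> \<noteq> 0" using assms(3) by simp
  ultimately show ?thesis using power_eq_1_iff[of "norm z" "nat \<bar>g\<bar>"] by simp
qed

definition scale_matrix :: "'n \<Rightarrow> int \<Rightarrow> int ^ 'n ^ 'n" where
  "scale_matrix k g = (\<chi> i j. if i = j then (if i = k then g else 1) else 0)"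

lemma det_scale_matrix: "det (scale_matrix k g) = g"
  by (subst det_diagonal) (auto simp: scale_matrix_def)

lemma torus_map_scale_matrix: "torus_map (scale_matrix k g) t = t(k := t k powi g)"
proof
  fix j
  have "t i powi (scale_matrix k g $ i $ j) = (if i = j then (if j = k then t k powi g else t j) else 1)" for i
    by (auto simp: scale_matrix_def)
  then show "torus_map (scale_matrix k g) t j = (t(k := t k powi g)) j"
    unfolding torus_map_def by simp
qed

lemma torus_fibre_scale_matrix:
  assumes g: "g \<noteq> 0" and y: "y \<in> torus"
  shows "{t \<in> torus. torus_map (scale_matrix k g) t = y} = (\<lambda>z. y(k := z)) ` {z. z powi g = y k}"
proof (intro set_eqI iffI)
  fix t assume "t \<in> {t \<in> torus. torus_map (scale_matrix k g) t = y}"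
  then have "t(k := t k powi g) = y"
    by (simp add: torus_map_scale_matrix)
  then show "t \<in> (\<lambda>z. y(k := z)) ` {z. z powi g = y k}"
    by (auto intro!: image_eqI[of _ _ "t k"])
next
  fix t assume "t \<in> (\<lambda>z. y(k := z)) ` {z. z powi g = y k}"
  then obtain z where z: "z powi g = y k" "t = y(k := z)" by blast
  have "norm (y k) = 1" using y by (simp add: torus_def)
  then have "norm z = 1" using norm_eq_1_if_power_int_eq[OF z(1) _ g] by simp
  then have "t \<in> torus" using y z(2) by (simp add: torus_def)
  then show "t \<in> {t \<in> torus. torus_map (scale_matrix k g) t = y}"
    using z by (simp add: torus_map_scale_matrix)
qed

lemma card_torus_fibre_scale_matrix:
  assumes "g \<noteq> 0" "y \<in> torus"
  shows "card {t \<in> torus. torus_map (scale_matrix k g) t = y} = nat \<bar>g\<bar>"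
proof -
  have "inj (\<lambda>z. y(k := z))" by (rule injI) (metis fun_upd_same)
  then show ?thesis
    using torus_nonzero[OF assms(2), of k] assms(1)
    by (simp add: torus_fibre_scale_matrix[OF assms] card_image inj_on_subset card_power_int_roots)
qed

lemma torus_det_cover_scale_matrix:
  assumes g: "g \<noteq> 0"
  shows "torus_det_cover (scale_matrix (k :: 'n :: finite) g)"
  unfolding torus_det_cover_def det_scale_matrix
proof (intro allI impI)
  fix Y :: "('n \<Rightarrow> complex) set" assume Y: "Y \<subseteq> torus"
  let ?f = "torus_map (scale_matrix k g)" and ?P = "torus_preimage (scale_matrix k g) Y"
  have fibre: "{t \<in> ?P. ?f t = y} = {t \<in> torus. ?f t = y}" if "y \<in> Y" for y
    using that by (auto simp: torus_preimage_def)
  have card_fibre: "card {t \<in> ?P. ?f t = y} = nat \<bar>g\<bar>" if "y \<in> Y" for y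
    unfolding fibre[OF that] using g subsetD[OF Y that] by (rule card_torus_fibre_scale_matrix)
  have "?f ` ?P = Y"
  proof
    show "?f ` ?P \<subseteq> Y" by (auto simp: torus_preimage_def)
    show "Y \<subseteq> ?f ` ?P"
    proof
      fix y assume y: "y \<in> Y"
      have "{t \<in> ?P. ?f t = y} \<noteq> {}"
        using card_fibre[OF y] g by (intro notI) simp
      then show "y \<in> ?f ` ?P" by blast
    qed
  qed
  moreover have "nat \<bar>g\<bar> > 0" using g by simp
  ultimately show "card ?P = nat \<bar>g\<bar> * card Y"
    using card_eq_mult_card_if_uniform_fibres card_fibre by blast
qed

section \<open>Reduction of a nonsingular matrix to elementary ones\<close>

definition identity_outside :: "'n set \<Rightarrow> int ^ 'n ^ 'n \<Rightarrow> bool" where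
  "identity_outside K M \<longleftrightarrow> (\<forall>i j. i \<notin> K \<or> j \<notin> K \<longrightarrow> M $ i $ j = (if i = j then 1 else 0))"

lemma row_add_entry:
  assumes "a \<noteq> b"
  shows "(shear_matrix a ((\<lambda>_. 0)(b := c)) ** M) $ i $ j = M $ i $ j + (if i = a then c * M $ b $ j else 0)"
proof -
  have "shear_matrix a ((\<lambda>_. 0)(b := c)) $ i $ l * M $ l $ j
      = (if l = i then M $ i $ j else 0) + (if l = b \<and> i = a then c * M $ b $ j else 0)" for l
    using assms by (auto simp: shear_matrix_def)
  then show ?thesis unfolding matrix_matrix_mult_def by (simp add: sum.distrib)
qed

lemma identity_outside_row_add:
  assumes "identity_outside K M" "a \<in> K" "b \<in> K" "a \<noteq> b"
  shows "identity_outside K (shear_matrix a ((\<lambda>_. 0)(b := c)) ** M)"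
  using assms unfolding identity_outside_def row_add_entry[OF assms(4)] by auto

lemma unimodular_cover_shear_matrix: "unimodular_cover (shear_matrix k r)"
  by (simp add: unimodular_cover_def torus_det_cover_shear_matrix abs_det_shear_matrix)

lemma move_column_entry_to_diagonal:
  assumes M: "identity_outside K M" and "i \<in> K" "k \<in> K" and ik: "i \<noteq> k"
    and single: "\<forall>j. j \<noteq> i \<longrightarrow> M $ j $ k = 0"
  shows "\<exists>E. unimodular_cover E \<and> identity_outside K (E ** M) \<and> (\<forall>l. l \<noteq> k \<longrightarrow> (E ** M) $ l $ k = 0)"
proof -
  define R1 where "R1 = shear_matrix k ((\<lambda>_. 0)(i := 1))"
  define R2 where "R2 = shear_matrix i ((\<lambda>_. 0)(k := - 1))"
  have entry1: "(R1 ** M) $ l $ j = M $ l $ j + (if l = k then M $ i $ j else 0)" for l j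
    unfolding R1_def by (simp add: row_add_entry[OF not_sym[OF ik]])
  have entry2: "(R2 ** (R1 ** M)) $ l $ j = (R1 ** M) $ l $ j - (if l = i then (R1 ** M) $ k $ j else 0)" for l j
    unfolding R2_def by (simp add: row_add_entry[OF ik])
  have "unimodular_cover (R2 ** R1)"
    unfolding R1_def R2_def by (intro unimodular_cover_mult unimodular_cover_shear_matrix)
  moreover have "identity_outside K (R2 ** (R1 ** M))"
    unfolding R1_def R2_def using assms by (intro identity_outside_row_add) auto
  moreover have "(R2 ** (R1 ** M)) $ l $ k = 0" if "l \<noteq> k" for l
    using that ik single by (simp add: entry1 entry2)
  ultimately show ?thesis by (metis matrix_mul_assoc)
qed

lemma column_reduction_step:
  assumes M: "identity_outside K M" and "a \<in> K" "b \<in> K" and ab: "a \<noteq> b"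
    and nonzero: "M $ a $ k \<noteq> 0" "M $ b $ k \<noteq> 0" and le: "\<bar>M $ b $ k\<bar> \<le> \<bar>M $ a $ k\<bar>"
  shows "\<exists>R. unimodular_cover R \<and> identity_outside K (R ** M)
           \<and> (\<Sum>l\<in>UNIV. nat \<bar>(R ** M) $ l $ k\<bar>) < (\<Sum>l\<in>UNIV. nat \<bar>M $ l $ k\<bar>)"
proof -
  \<comment> \<open>the sign \<open>c\<close> makes the row operation lower \<open>\<bar>M $ a $ k\<bar>\<close> by \<open>\<bar>M $ b $ k\<bar>\<close>\<close>
  define c where "c = - (sgn (M $ a $ k) * sgn (M $ b $ k))"
  define R where "R = shear_matrix a ((\<lambda>_. 0)(b := c))"
  have entry: "(R ** M) $ l $ k = M $ l $ k + (if l = a then c * M $ b $ k else 0)" for l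
    unfolding R_def by (rule row_add_entry[OF ab])
  have reduced: "\<bar>M $ a $ k + c * M $ b $ k\<bar> = \<bar>M $ a $ k\<bar> - \<bar>M $ b $ k\<bar>"
    using nonzero le unfolding c_def
    by (cases "M $ a $ k > 0"; cases "M $ b $ k > 0") (auto simp: abs_if sgn_if)
  have "(\<Sum>l\<in>UNIV. nat \<bar>(R ** M) $ l $ k\<bar>) < (\<Sum>l\<in>UNIV. nat \<bar>M $ l $ k\<bar>)"
    using reduced nonzero(2) by (intro sum_strict_mono_ex1) (auto simp: entry)
  moreover have "identity_outside K (R ** M)"
    unfolding R_def using assms by (intro identity_outside_row_add) auto
  moreover have "unimodular_cover R"
    unfolding R_def by (rule unimodular_cover_shear_matrix)
  ultimately show ?thesis by blast
qed

lemma column_clearing: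
  assumes "k \<in> K" "identity_outside K M"
  shows "\<exists>E. unimodular_cover E \<and> identity_outside K (E ** M) \<and> (\<forall>i. i \<noteq> k \<longrightarrow> (E ** M) $ i $ k = 0)"
  using assms(2)
proof (induction "\<Sum>i\<in>UNIV. nat \<bar>M $ i $ k\<bar>" arbitrary: M rule: less_induct)
  case less
  have in_K: "i \<in> K" if "M $ i $ k \<noteq> 0" for i
    using less.prems assms(1) that unfolding identity_outside_def by (metis (full_types))
  consider (cleared) "\<forall>i. i \<noteq> k \<longrightarrow> M $ i $ k = 0"
    | (two) a b where "a \<noteq> b" "M $ a $ k \<noteq> 0" "M $ b $ k \<noteq> 0" "\<bar>M $ b $ k\<bar> \<le> \<bar>M $ a $ k\<bar>"
    | (one) i where "i \<noteq> k" "M $ i $ k \<noteq> 0" "\<forall>j. j \<noteq> i \<longrightarrow> M $ j $ k = 0"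
    by (metis linear)
  then show ?case
  proof cases
    case cleared
    then show ?thesis
      using less.prems unimodular_cover_shear_matrix[of k "\<lambda>_. 0"]
      by (intro exI[of _ "mat 1"]) (simp add: shear_matrix_zero)
  next
    case (two a b)
    then obtain R where R: "unimodular_cover R" "identity_outside K (R ** M)"
        "(\<Sum>l\<in>UNIV. nat \<bar>(R ** M) $ l $ k\<bar>) < (\<Sum>l\<in>UNIV. nat \<bar>M $ l $ k\<bar>)"
      using column_reduction_step[OF less.prems in_K in_K] by blast
    then obtain E where E: "unimodular_cover E" "identity_outside K (E ** (R ** M))"
        "\<forall>i. i \<noteq> k \<longrightarrow> (E ** (R ** M)) $ i $ k = 0"
      using less.hyps by blast
    show ?thesis
      using unimodular_cover_mult[OF E(1) R(1)] E(2,3)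
      by (intro exI[of _ "E ** R"]) (simp add: matrix_mul_assoc)
  next
    case (one i)
    show ?thesis
      by (rule move_column_entry_to_diagonal[OF less.prems in_K[OF one(2)] assms(1) one(1,3)])
  qed
qed

lemma column_cleared_factorization:
  fixes M :: "int ^ 'n ^ 'n"
  assumes cleared: "\<forall>i. i \<noteq> k \<longrightarrow> M $ i $ k = 0"
  shows "M = (\<chi> i j. if i = k \<or> j = k then (if i = j then 1 else 0) else M $ i $ j)
             ** (shear_matrix k (\<lambda>j. M $ k $ j) ** scale_matrix k (M $ k $ k))"
    (is "M = ?M' ** ?X")
proof -
  have X: "?X $ l $ j = (if l = k then M $ k $ j else if l = j then 1 else 0)" for l j
  proof -
    have "shear_matrix k (\<lambda>j. M $ k $ j) $ l $ m * scale_matrix k (M $ k $ k) $ m $ j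
        = (if m = j then shear_matrix k (\<lambda>j. M $ k $ j) $ l $ j * (if j = k then M $ k $ k else 1) else 0)"
      for m
      by (auto simp: scale_matrix_def)
    then show ?thesis
      by (auto simp: matrix_matrix_mult_def shear_matrix_def)
  qed
  have "(?M' ** ?X) $ i $ j = M $ i $ j" for i j
  proof (cases "i = k")
    case True
    have "?M' $ i $ l * ?X $ l $ j = (if l = k then M $ k $ j else 0)" for l
      using True by (auto simp: X)
    then show ?thesis using True by (simp only: matrix_matrix_mult_def vec_lambda_beta) simp
  next
    case False
    have "?M' $ i $ l * ?X $ l $ j = (if l = j then (if j = k then 0 else M $ i $ j) else 0)" for l
      using False by (auto simp: X)
    then have "(?M' ** ?X) $ i $ j = (if j = k then 0 else M $ i $ j)"
      by (simp only: matrix_matrix_mult_def vec_lambda_beta) simp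
    then show ?thesis using False cleared by simp
  qed
  then show ?thesis by (simp add: vec_eq_iff)
qed

lemma torus_det_cover_if_identity_outside:
  "finite K \<Longrightarrow> identity_outside K M \<Longrightarrow> det M \<noteq> 0 \<Longrightarrow> torus_det_cover M"
proof (induction K arbitrary: M rule: finite_induct)
  case empty
  then have "M = mat 1" unfolding identity_outside_def by (simp add: vec_eq_iff mat_def)
  then show ?case using torus_det_cover_one by simp
next
  case (insert k K)
  obtain E where E: "unimodular_cover E" "identity_outside (insert k K) (E ** M)"
      "\<forall>i. i \<noteq> k \<longrightarrow> (E ** M) $ i $ k = 0"
    using column_clearing[of k "insert k K" M] insert.prems(1) by blast
  define M' where "M' = (\<chi> i j. if i = k \<or> j = k then (if i = j then 1 else 0) else (E ** M) $ i $ j)"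
  define S where "S = shear_matrix k (\<lambda>j. (E ** M) $ k $ j)"
  define g where "g = (E ** M) $ k $ k"
  have factor: "E ** M = M' ** (S ** scale_matrix k g)"
    unfolding M'_def S_def g_def by (rule column_cleared_factorization[OF E(3)])
  have "det M' * det S * g = det E * det M"
    using arg_cong[OF factor, of det] by (simp add: det_mul det_scale_matrix)
  then have "det M' \<noteq> 0" "g \<noteq> 0"
    using E(1) insert.prems(2) unfolding unimodular_cover_def by auto
  moreover have "identity_outside K M'"
    using E(2) unfolding identity_outside_def M'_def by auto
  ultimately have "torus_det_cover M'"
    using insert.IH by blast
  moreover have "torus_det_cover (S ** scale_matrix k g)"
    unfolding S_def using torus_det_cover_scale_matrix[OF \<open>g \<noteq> 0\<close>]
    by (rule torus_det_cover_mult[OF torus_det_cover_shear_matrix])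
  ultimately have "torus_det_cover (E ** M)"
    unfolding factor by (rule torus_det_cover_mult)
  then show ?case by (rule torus_det_cover_cancel_left[OF E(1)])
qed

lemma torus_det_cover_if_det_nonzero: "det (M :: int ^ 'n ^ 'n) \<noteq> 0 \<Longrightarrow> torus_det_cover M"
  by (rule torus_det_cover_if_identity_outside[of UNIV]) (simp_all add: identity_outside_def)

section \<open>Characters and annihilators\<close>

definition character :: "('n \<Rightarrow> complex) \<Rightarrow> int ^ 'n \<Rightarrow> complex" where
  "character t h = (\<Prod>j\<in>UNIV. t j powi (h $ j))"

definition annihilator :: "(int ^ 'n) set \<Rightarrow> ('n \<Rightarrow> complex) set" where
  "annihilator H = {t \<in> torus. \<forall>h\<in>H. character t h = 1}"

lemma character_add: "t \<in> torus \<Longrightarrow> character t (x + y) = character t x * character t y"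
  unfolding character_def by (simp add: torus_nonzero power_int_add prod.distrib)

lemma character_axis: "character t (axis j 1) = t j"
proof -
  have "t l powi (axis j 1 $ l) = (if l = j then t j else 1)" for l
    by (simp add: axis_def)
  then show ?thesis unfolding character_def by simp
qed

lemma norm_character: "t \<in> torus \<Longrightarrow> norm (character t x) = 1"
  unfolding character_def torus_def by (simp add: prod_norm[symmetric] norm_power_int)

lemma character_matrix_vector_mult:
  assumes "t \<in> torus"
  shows "character t (M *v h) = character (torus_map M t) h"
proof -
  have "character t (M *v h) = (\<Prod>i\<in>UNIV. \<Prod>j\<in>UNIV. t i powi (M $ i $ j * h $ j))"
    unfolding character_def matrix_vector_mult_def using torus_nonzero[OF assms]
    by (simp add: power_int_sum)
  also have "\<dots> = (\<Prod>j\<in>UNIV. \<Prod>i\<in>UNIV. t i powi (M $ i $ j * h $ j))"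
    by (rule prod.swap)
  also have "\<dots> = character (torus_map M t) h"
    unfolding character_def torus_map_def by (simp add: power_int_prod power_int_mult)
  finally show ?thesis .
qed

lemma multiplicative_eq_character:
  fixes f :: "int ^ 'n \<Rightarrow> complex"
  assumes mult: "\<And>x y. f (x + y) = f x * f y" and nonzero: "\<And>x. f x \<noteq> 0"
  shows "f x = character (\<lambda>j. f (axis j 1)) x"
proof -
  have f0: "f 0 = 1"
    using mult[of 0 0] nonzero[of 0] by simp
  have scale: "f (k *s y) = f y powi k" for k y
  proof (induction k rule: int_induct[where k = 0])
    case base
    show ?case by (simp add: f0)
  next
    case (step1 i)
    have "(i + 1) *s y = i *s y + y" by (simp add: vec_eq_iff algebra_simps)
    then show ?case using step1 nonzero[of y] by (simp add: mult power_int_add)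
  next
    case (step2 i)
    have "i *s y = (i - 1) *s y + y" by (simp add: vec_eq_iff algebra_simps)
    then have "f ((i - 1) *s y) * f y = f (i *s y)"
      by (metis mult)
    also have "\<dots> = f y powi (i - 1) * f y"
      using step2 nonzero[of y] by (simp add: power_int_minus_mult)
    finally show ?case using nonzero[of y] by simp
  qed
  have sum: "f (\<Sum>j\<in>F. g j) = (\<Prod>j\<in>F. f (g j))" for F and g :: "'n \<Rightarrow> int ^ 'n"
    by (induction F rule: infinite_finite_induct) (simp_all add: f0 mult)
  have "f x = f (\<Sum>j\<in>UNIV. x $ j *s axis j 1)" by (simp add: basis_expansion)
  also have "\<dots> = character (\<lambda>j. f (axis j 1)) x"
    by (simp add: sum scale character_def)
  finally show ?thesis .
qed

lemma annihilator_subset_torus: "annihilator H \<subseteq> torus"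
  unfolding annihilator_def by auto

lemma annihilator_matrix_image:
  "annihilator ((*v) M ` H) = torus_preimage M (annihilator H)"
  unfolding annihilator_def torus_preimage_def
  by (auto simp: character_matrix_vector_mult torus_map_in_torus)

lemma card_annihilator_matrix_image:
  assumes "det M \<noteq> 0"
  shows "card (annihilator ((*v) M ` H)) = nat \<bar>det M\<bar> * card (annihilator H)"
  using torus_det_cover_if_det_nonzero[OF assms] annihilator_subset_torus[of H]
  unfolding annihilator_matrix_image torus_det_cover_def by blast

section \<open>Homomorphisms from a finite quotient into \<open>G\<close>\<close>

lemma coset_eq_iff: "coset (zspan X) x = coset (zspan X) y \<longleftrightarrow> x - y \<in> zspan X"
proof
  assume eq: "coset (zspan X) x = coset (zspan X) y"
  have "y \<in> coset (zspan X) y"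
    unfolding coset_def zspan_eq_span by (intro CollectI exI[of _ 0]) (simp add: int_vec.span_zero)
  then have "y \<in> coset (zspan X) x" by (simp add: eq)
  then obtain h where "h \<in> zspan X" "y = x + h"
    unfolding coset_def by blast
  then show "x - y \<in> zspan X"
    unfolding zspan_eq_span by (simp add: int_vec.span_neg)
next
  assume d: "x - y \<in> zspan X"
  show "coset (zspan X) x = coset (zspan X) y"
  proof (intro set_eqI iffI)
    fix z assume "z \<in> coset (zspan X) x"
    then obtain h where h: "h \<in> zspan X" "z = x + h" unfolding coset_def by blast
    then show "z \<in> coset (zspan X) y"
      using d unfolding coset_def zspan_eq_span
      by (intro CollectI exI[of _ "(x - y) + h"]) (simp add: int_vec.span_add)
  next
    fix z assume "z \<in> coset (zspan X) y"
    then obtain h where h: "h \<in> zspan X" "z = y + h" unfolding coset_def by blast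
    then show "z \<in> coset (zspan X) x"
      using d unfolding coset_def zspan_eq_span
      by (intro CollectI exI[of _ "h - (x - y)"]) (simp add: int_vec.span_diff)
  qed
qed

definition characters_of_hom ::
    "(int ^ 'n) set \<Rightarrow> nat \<Rightarrow> ((int ^ 'n) set \<Rightarrow> (nat \<Rightarrow> complex) \<times> (nat \<Rightarrow> real)) \<Rightarrow> nat \<Rightarrow> 'n \<Rightarrow> complex"
  where "characters_of_hom H p \<phi> = (\<lambda>i\<in>{..<p}. \<lambda>j. fst (\<phi> (coset H (axis j 1))) i)"

definition hom_of_characters ::
    "(int ^ 'n) set \<Rightarrow> nat \<Rightarrow> (nat \<Rightarrow> 'n \<Rightarrow> complex) \<Rightarrow> (int ^ 'n) set \<Rightarrow> (nat \<Rightarrow> complex) \<times> (nat \<Rightarrow> real)"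
  where "hom_of_characters H p T =
    (\<lambda>c\<in>tor_quot H. ((\<lambda>i. if i < p then character (T i) (SOME x. c = coset H x) else 1), (\<lambda>i. 0)))"

context
  fixes X :: "(int ^ 'n) set"
  assumes full_rank: "zrank (zspan X) = CARD('n)"
begin

lemma torsion_mod_zspan: "\<exists>k>0. k *s x \<in> zspan X"
  using zrank_full_imp_torsion[OF full_rank, of x] by (simp add: zspan_eq_span int_vec.span_span)

lemma tor_quot_full_rank: "tor_quot (zspan X) = range (coset (zspan X))"
proof -
  have "coset (zspan X) x \<in> tor_quot (zspan X)" for x
    using torsion_mod_zspan[of x] unfolding tor_quot_def by blast
  then show ?thesis unfolding tor_quot_def by blast
qed

lemma hom_tor_coset:
  assumes "\<phi> \<in> hom_tor (zspan X) p q"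
  shows "\<phi> (coset (zspan X) x) =
    ((\<lambda>i. if i < p then character (\<lambda>j. fst (\<phi> (coset (zspan X) (axis j 1))) i) x else 1), (\<lambda>i. 0))"
proof -
  define \<psi> where "\<psi> x = \<phi> (coset (zspan X) x)" for x
  have hom: "\<psi> (x + y) = G_op (\<psi> x) (\<psi> y)" for x y
    using assms unfolding hom_tor_def \<psi>_def tor_quot_full_rank by blast
  have carrier: "\<psi> x \<in> G_carrier p q" for x
    using assms unfolding hom_tor_def \<psi>_def tor_quot_full_rank by blast
  have "fst (\<psi> x) i = (if i < p then character (\<lambda>j. fst (\<psi> (axis j 1)) i) x else 1)" for i
  proof (cases "i < p")
    case True
    have mult: "fst (\<psi> (y + z)) i = fst (\<psi> y) i * fst (\<psi> z) i" for y z
      using hom[of y z] by (simp add: G_op_def)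
    have nonzero: "fst (\<psi> y) i \<noteq> 0" for y
      using carrier[of y] True unfolding G_carrier_def by auto
    show ?thesis
      unfolding if_P[OF True] by (rule multiplicative_eq_character[of "\<lambda>y. fst (\<psi> y) i", OF mult nonzero])
  next
    case False
    then show ?thesis using carrier[of x] unfolding G_carrier_def by auto
  qed
  moreover have "snd (\<psi> x) i = 0" for i
  proof -
    have additive: "Modules.additive (\<lambda>y. snd (\<psi> y) i)"
      unfolding Modules.additive_def using hom by (simp add: G_op_def)
    obtain k where k: "k > 0" "k *s x \<in> zspan X"
      using torsion_mod_zspan by blast
    then have "coset (zspan X) (k *s x) = coset (zspan X) 0"
      by (simp add: coset_eq_iff)
    then have "\<psi> (k *s x) = \<psi> 0"
      unfolding \<psi>_def by simp
    then have "of_int k * snd (\<psi> x) i = 0"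
      using additive_scale_int[OF additive, of k x] additive.zero[OF additive] by simp
    then show ?thesis using k(1) by simp
  qed
  ultimately show ?thesis unfolding \<psi>_def by (simp add: prod_eq_iff fun_eq_iff)
qed

lemma characters_of_hom_in_annihilator:
  assumes "\<phi> \<in> hom_tor (zspan X) p q"
  shows "characters_of_hom (zspan X) p \<phi> \<in> {..<p} \<rightarrow>\<^sub>E annihilator (zspan X)"
  unfolding characters_of_hom_def
proof (rule restrict_PiE_iff[THEN iffD2], intro ballI)
  fix i assume i: "i \<in> {..<p}"
  let ?t = "\<lambda>j. fst (\<phi> (coset (zspan X) (axis j 1))) i"
  have "\<phi> (coset (zspan X) (axis j 1)) \<in> G_carrier p q" for j
    using assms unfolding hom_tor_def tor_quot_full_rank by blast
  then have "?t \<in> torus"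
    using i unfolding G_carrier_def torus_def by (auto simp: case_prod_beta)
  moreover have "character ?t h = 1" if "h \<in> zspan X" for h
  proof -
    have "character ?t h = fst (\<phi> (coset (zspan X) h)) i"
      using i hom_tor_coset[OF assms, of h] by simp
    also have "coset (zspan X) h = coset (zspan X) 0"
      using that by (simp add: coset_eq_iff)
    also have "fst (\<phi> (coset (zspan X) 0)) i = 1"
      using i hom_tor_coset[OF assms, of 0] by (simp add: character_def)
    finally show ?thesis .
  qed
  ultimately show "?t \<in> annihilator (zspan X)"
    unfolding annihilator_def by blast
qed

lemma hom_of_characters_coset:
  assumes "T \<in> {..<p} \<rightarrow>\<^sub>E annihilator (zspan X)"
  shows "hom_of_characters (zspan X) p T (coset (zspan X) x) =
    ((\<lambda>i. if i < p then character (T i) x else 1), (\<lambda>i. 0))"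
proof -
  define y where "y = (SOME y. coset (zspan X) x = coset (zspan X) y)"
  have "coset (zspan X) x = coset (zspan X) y"
    unfolding y_def by (rule someI_ex) blast
  then have d: "y - x \<in> zspan X" using coset_eq_iff[of X y x] by simp
  have "character (T i) y = character (T i) x" if "i < p" for i
  proof -
    have t: "T i \<in> annihilator (zspan X)" using assms that by auto
    then have "character (T i) y = character (T i) x * character (T i) (y - x)"
      using annihilator_subset_torus character_add[of "T i" x "y - x"] by auto
    also have "character (T i) (y - x) = 1"
      using t d unfolding annihilator_def by blast
    finally show ?thesis by simp
  qed
  then show ?thesis
    unfolding hom_of_characters_def tor_quot_full_rank by (simp add: y_def[symmetric] fun_eq_iff)
qed

lemma hom_of_characters_in_hom_tor:
  assumes T: "T \<in> {..<p} \<rightarrow>\<^sub>E annihilator (zspan X)"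
  shows "hom_of_characters (zspan X) p T \<in> hom_tor (zspan X) p q"
proof -
  have torus: "T i \<in> torus" if "i < p" for i
    using T that annihilator_subset_torus by auto
  show ?thesis
    unfolding hom_tor_def tor_quot_full_rank
  proof (intro CollectI conjI ballI allI impI)
    show "hom_of_characters (zspan X) p T \<in> extensional (range (coset (zspan X)))"
      unfolding hom_of_characters_def tor_quot_full_rank by simp
  next
    fix c assume "c \<in> range (coset (zspan X))"
    then show "hom_of_characters (zspan X) p T c \<in> G_carrier p q"
      using torus by (auto simp: hom_of_characters_coset[OF T] G_carrier_def norm_character)
  next
    fix x y
    show "hom_of_characters (zspan X) p T (coset (zspan X) (x + y)) =
        G_op (hom_of_characters (zspan X) p T (coset (zspan X) x))
             (hom_of_characters (zspan X) p T (coset (zspan X) y))"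
      using torus by (simp add: hom_of_characters_coset[OF T] G_op_def fun_eq_iff character_add)
  qed
qed

lemma hom_of_characters_of_hom:
  assumes \<phi>: "\<phi> \<in> hom_tor (zspan X) p q"
  shows "hom_of_characters (zspan X) p (characters_of_hom (zspan X) p \<phi>) = \<phi>"
proof
  fix c
  show "hom_of_characters (zspan X) p (characters_of_hom (zspan X) p \<phi>) c = \<phi> c"
  proof (cases "c \<in> range (coset (zspan X))")
    case True
    then obtain x where c: "c = coset (zspan X) x" by blast
    have "hom_of_characters (zspan X) p (characters_of_hom (zspan X) p \<phi>) c
        = ((\<lambda>i. if i < p then character (characters_of_hom (zspan X) p \<phi> i) x else 1), (\<lambda>i. 0))"
      unfolding c by (rule hom_of_characters_coset[OF characters_of_hom_in_annihilator[OF \<phi>]])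
    also have "\<dots> = \<phi> c"
      unfolding c hom_tor_coset[OF \<phi>, of x] by (simp add: characters_of_hom_def fun_eq_iff)
    finally show ?thesis .
  next
    case False
    have "\<phi> \<in> extensional (range (coset (zspan X)))"
      using \<phi> unfolding hom_tor_def tor_quot_full_rank by blast
    then have "\<phi> c = undefined" using False by (rule extensional_arb)
    moreover have "hom_of_characters (zspan X) p (characters_of_hom (zspan X) p \<phi>) c = undefined"
      unfolding hom_of_characters_def tor_quot_full_rank by (simp only: restrict_apply if_not_P[OF False])
    ultimately show ?thesis by simp
  qed
qed

lemma characters_of_hom_of_characters:
  assumes T: "T \<in> {..<p} \<rightarrow>\<^sub>E annihilator (zspan X)"
  shows "characters_of_hom (zspan X) p (hom_of_characters (zspan X) p T) = T"
proof
  fix i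
  show "characters_of_hom (zspan X) p (hom_of_characters (zspan X) p T) i = T i"
  proof (cases "i < p")
    case True
    then have "characters_of_hom (zspan X) p (hom_of_characters (zspan X) p T) i
        = (\<lambda>j. fst (hom_of_characters (zspan X) p T (coset (zspan X) (axis j 1))) i)"
      by (simp add: characters_of_hom_def)
    also have "\<dots> = (\<lambda>j. character (T i) (axis j 1))"
      using True by (simp only: hom_of_characters_coset[OF T] fst_conv if_P)
    also have "\<dots> = T i"
      by (simp only: character_axis)
    finally show ?thesis .
  next
    case False
    then have "T i = undefined" using PiE_arb[OF T] by simp
    then show ?thesis using False by (simp add: characters_of_hom_def)
  qed
qed

lemma card_hom_tor: "card (hom_tor (zspan X) p q) = card (annihilator (zspan X)) ^ p"
proof -
  have "bij_betw (characters_of_hom (zspan X) p) (hom_tor (zspan X) p q) ({..<p} \<rightarrow>\<^sub>E annihilator (zspan X))"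
  proof (rule bij_betw_byWitness[where f' = "hom_of_characters (zspan X) p"])
    show "\<forall>\<phi>\<in>hom_tor (zspan X) p q. hom_of_characters (zspan X) p (characters_of_hom (zspan X) p \<phi>) = \<phi>"
      by (simp add: hom_of_characters_of_hom)
    show "\<forall>T\<in>{..<p} \<rightarrow>\<^sub>E annihilator (zspan X).
        characters_of_hom (zspan X) p (hom_of_characters (zspan X) p T) = T"
      by (simp add: characters_of_hom_of_characters)
    show "characters_of_hom (zspan X) p ` hom_tor (zspan X) p q \<subseteq> {..<p} \<rightarrow>\<^sub>E annihilator (zspan X)"
      using characters_of_hom_in_annihilator by blast
    show "hom_of_characters (zspan X) p ` ({..<p} \<rightarrow>\<^sub>E annihilator (zspan X)) \<subseteq> hom_tor (zspan X) p q"
      using hom_of_characters_in_hom_tor by blast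
  qed
  then show ?thesis by (simp add: bij_betw_same_card card_PiE)
qed

end

section \<open>The characteristic polynomial at zero\<close>

lemma poly_char_poly_G_0:
  "poly (char_poly_G p q (A :: (int ^ 'n) list)) 0 =
     (\<Sum>S\<in>Pow {..<length A}.
        if zrank (gen_sub A S) = CARD('n) then (-1) ^ card S * int (mult_G A S p q) else 0)"
proof -
  have "poly (monom ((-1) ^ card S * int (mult_G A S p q))
          (zrank (UNIV :: (int ^ 'n) set) - zrank (gen_sub A S))) 0
      = (if zrank (gen_sub A S) = CARD('n) then (-1) ^ card S * int (mult_G A S p q) else 0)" for S
    using zrank_le_CARD[of "gen_sub A S"] by (simp add: poly_monom zrank_UNIV power_0_left)
  then show ?thesis
    unfolding char_poly_G_def by (simp add: poly_sum)
qed

lemma gen_sub_map_matrix: "gen_sub (map ((*v) M) A) S = (*v) M ` gen_sub A S"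
proof -
  have "{map ((*v) M) A ! i | i. i \<in> S \<and> i < length (map ((*v) M) A)}
      = (*v) M ` {A ! i | i. i \<in> S \<and> i < length A}"
    by force
  then show ?thesis unfolding gen_sub_def by (simp add: zspan_matrix_image)
qed

lemma mult_G_map_matrix:
  fixes M :: "int ^ 'n ^ 'n"
  assumes det: "det M \<noteq> 0" and full_rank: "zrank (gen_sub A S) = CARD('n)"
  shows "mult_G (map ((*v) M) A) S p q = nat \<bar>det M\<bar> ^ p * mult_G A S p q"
proof -
  define Y where "Y = {A ! i | i. i \<in> S \<and> i < length A}"
  have H: "gen_sub A S = zspan Y" and MH: "gen_sub (map ((*v) M) A) S = zspan ((*v) M ` Y)"
    unfolding gen_sub_map_matrix by (simp_all add: gen_sub_def Y_def zspan_matrix_image)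
  have "zrank (zspan ((*v) M ` Y)) = CARD('n)"
    using full_rank inj_matrix_vector_mult_if_det_nonzero[OF det]
    by (simp add: H zspan_matrix_image zrank_matrix_image)
  then have "mult_G (map ((*v) M) A) S p q = card (annihilator (zspan ((*v) M ` Y))) ^ p"
    unfolding mult_G_def MH by (rule card_hom_tor)
  also have "\<dots> = (nat \<bar>det M\<bar> * card (annihilator (zspan Y))) ^ p"
    by (simp add: zspan_matrix_image card_annihilator_matrix_image[OF det])
  also have "\<dots> = nat \<bar>det M\<bar> ^ p * mult_G A S p q"
    using full_rank unfolding mult_G_def H by (simp add: card_hom_tor power_mult_distrib)
  finally show ?thesis .
qed

lemma poly_char_poly_G_0_map_matrix:
  fixes M :: "int ^ 'n ^ 'n"
  assumes "p > 0"
  shows "poly (char_poly_G p q (map ((*v) M) A)) 0 = \<bar>det M\<bar> ^ p * poly (char_poly_G p q A) 0"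
proof (cases "det M = 0")
  case True
  have "zrank (gen_sub (map ((*v) M) A) S) \<noteq> CARD('n)" for S
  proof
    assume "zrank (gen_sub (map ((*v) M) A) S) = CARD('n)"
    then have "CARD('n) \<le> zrank (range ((*v) M))"
      unfolding gen_sub_map_matrix by (metis image_mono subset_UNIV zrank_mono)
    then show False
      using True det_nonzero_if_zrank_range[of M] zrank_le_CARD[of "range ((*v) M)"] by simp
  qed
  then show ?thesis using True assms by (simp add: poly_char_poly_G_0)
next
  case False
  then have "inj ((*v) M)" by (rule inj_matrix_vector_mult_if_det_nonzero)
  then have rank: "zrank (gen_sub (map ((*v) M) A) S) = zrank (gen_sub A S)" for S
    by (simp add: gen_sub_map_matrix zrank_matrix_image)
  show ?thesis
    unfolding poly_char_poly_G_0 sum_distrib_left length_map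
  proof (rule sum.cong[OF refl])
    fix S
    show "(if zrank (gen_sub (map ((*v) M) A) S) = CARD('n)
           then (-1) ^ card S * int (mult_G (map ((*v) M) A) S p q) else 0)
        = \<bar>det M\<bar> ^ p * (if zrank (gen_sub A S) = CARD('n)
           then (-1) ^ card S * int (mult_G A S p q) else 0)"
      using mult_G_map_matrix[OF False, of A S p q]
      by (simp add: rank mult_ac)
  qed
qed

theorem mainTheorem7:
  fixes \<sigma> :: "int ^ 'n \<Rightarrow> int ^ 'n"
    and A :: "(int ^ 'n) list"
    and p q :: nat
  assumes hom: "\<And>x y. \<sigma> (x + y) = \<sigma> x + \<sigma> y"
    and p: "p > 0"
  shows "poly (char_poly_G p q (map \<sigma> A)) 0
       = \<bar>det (hom_matrix \<sigma>)\<bar> ^ p * poly (char_poly_G p q A) 0"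
proof -
  have "Modules.additive \<sigma>"
    using hom by unfold_locales
  then have "\<sigma> x = hom_matrix \<sigma> *v x" for x
    unfolding hom_matrix_def by (rule additive_eq_hom_matrix)
  then have "map \<sigma> A = map ((*v) (hom_matrix \<sigma>)) A"
    by simp
  then show ?thesis
    by (simp only:) (rule poly_char_poly_G_0_map_matrix[OF p])
qed

end
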